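(* Let $r_L, r_R, k$ be positive integers and let $\mathbf{U}$ be an $(r_R r_L)\times k$ random matrix. Then there exist (nonrandom) linear subspaces $\mathcal{S}_{\mathbf{U}\circ}\subseteq\mathbb{R}^{r_R}$ and $\mathcal{S}_{\circ\mathbf{U}}\subseteq\mathbb{R}^{r_L}$ such that: 1. $\mathrm{span}(\mathbf{U})\subseteq \mathcal{S}_{\mathbf{U}\circ}\otimes\mathcal{S}_{\circ\mathbf{U}}$ almost surely; 2. if $\mathcal{S}_R\subseteq\mathbb{R}^{r_R}$ and $\mathcal{S}_L\subseteq\mathbb{R}^{r_L}$ is another pair of linear subspaces satisfying $\mathrm{span}(\mathbf{U})\subseteq\mathcal{S}_R\otimes\mathcal{S}_L$ almost surely, then $\mathcal{S}_{\mathbf{U}\circ}\otimes\mathcal{S}_{\circ\mathbf{U}}\subseteq\mathcal{S}_R\otimes\mathcal{S}_L$.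
   Context: For a matrix $\mathbf{A}$, $\mathrm{span}(\mathbf{A})$ is the linear span of its columns. For linear subspaces $\mathcal{S}_1\subseteq\mathbb{R}^{m_1}$ and $\mathcal{S}_2\subseteq\mathbb{R}^{m_2}$, $\mathcal{S}_1\otimes\mathcal{S}_2$ denotes the linear subspace of $\mathbb{R}^{m_1m_2}$ spanned by the vectors $\{\mathbf{v}_1\otimes\mathbf{v}_2:\mathbf{v}_1\in\mathcal{S}_1,\mathbf{v}_2\in\mathcal{S}_2\}$, where $\mathbf{v}_1\otimes\mathbf{v}_2$ is the Kronecker product of vectors. *)

theory Defs
  imports "HOL-Probability.Probability"
begin

(* Coordinates of R^(m1 m2) are indexed by pairs; the lexicographic enumeration of the
   pairs is the usual row ordering of the Kronecker product, i.e. (i, j) |-> (i - 1) m2 + j. *)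
definition kron_vec :: "real ^ 'm \<Rightarrow> real ^ 'n \<Rightarrow> real ^ ('m \<times> 'n)" where
  "kron_vec v w = (\<chi> p. v $ fst p * w $ snd p)"

definition kron_subspace :: "(real ^ 'm) set \<Rightarrow> (real ^ 'n) set \<Rightarrow> (real ^ ('m \<times> 'n)) set" where
  "kron_subspace S T = span {kron_vec v w | v w. v \<in> S \<and> w \<in> T}"

definition column_span :: "real ^ 'k ^ 'm \<Rightarrow> (real ^ 'm) set" where
  "column_span A = span (columns A)"

end

theory Submission
  imports Defs
begin

text \<open>
  Read a vector of the tensor space as a matrix, with coordinate \<open>(i, j)\<close> in row \<open>i\<close> and
  column \<open>j\<close>. Then \<open>S \<otimes> T\<close> consists of exactly the matrices whose columns all lie in \<open>S\<close> and
  whose rows all lie in \<open>T\<close> (\<open>mem_kron_subspace_iff\<close>). The two conditions are independent of each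
  other, so intersections of tensor products are taken factor by factor:
  \<open>(S \<inter> S') \<otimes> (T \<inter> T') = (S \<otimes> T) \<inter> (S' \<otimes> T')\<close> (\<open>kron_subspace_Int\<close>).

  Call a pair of subspaces admissible if its tensor product contains the span of the random
  matrix almost surely. The pair of full spaces is admissible, and by the intersection formula
  so is the factorwise intersection of two admissible pairs. Hence an admissible pair with the
  least total dimension is contained, factor by factor, in every other admissible pair: otherwise
  intersecting the two would lower the total dimension.
\<close>

definition kron_row :: "'m::finite \<Rightarrow> real ^ ('m \<times> 'n::finite) \<Rightarrow> real ^ 'n" where
  "kron_row i x = (\<chi> j. x $ (i, j))"

definition kron_col :: "'n::finite \<Rightarrow> real ^ ('m::finite \<times> 'n) \<Rightarrow> real ^ 'm" where
  "kron_col j x = (\<chi> i. x $ (i, j))"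

lemma linear_kron_row:
  fixes i :: "'m::finite"
  shows "linear (kron_row i :: real ^ ('m \<times> 'n::finite) \<Rightarrow> _)"
  by (rule linearI) (simp_all add: kron_row_def vec_eq_iff)

lemma linear_kron_col:
  fixes j :: "'n::finite"
  shows "linear (kron_col j :: real ^ ('m::finite \<times> 'n) \<Rightarrow> _)"
  by (rule linearI) (simp_all add: kron_col_def vec_eq_iff)

lemma kron_row_kron_vec: "kron_row i (kron_vec v w) = v $ i *\<^sub>R w"
  by (simp add: kron_row_def kron_vec_def vec_eq_iff)

lemma kron_col_kron_vec: "kron_col j (kron_vec v w) = w $ j *\<^sub>R v"
  by (simp add: kron_col_def kron_vec_def vec_eq_iff)

lemma linear_projection_onto_subspace:
  fixes S :: "'a::euclidean_space set"
  assumes "subspace S"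
  obtains P where "linear P" "\<And>x. P x \<in> S" "\<And>x. x \<in> S \<Longrightarrow> P x = x"
proof -
  have "\<exists>P. range P \<subseteq> S \<and> linear P \<and> (\<forall>v\<in>S. P (id v) = v)"
    using linear_exists_left_inverse_on[of "id :: 'a \<Rightarrow> 'a" S] assms linear_id by auto
  then show ?thesis
    using that by auto
qed

text \<open>
  If \<open>P\<close> fixes every column of \<open>x\<close>, applying \<open>P\<close> columnwise to \<open>x = (\<Sum>i. e\<^sub>i \<otimes> (row i of x))\<close>
  leaves \<open>x\<close> unchanged, so the unit vectors may be replaced by their images under \<open>P\<close>.
\<close>

lemma kron_expansion:
  fixes x :: "real ^ ('m::finite \<times> 'n::finite)"
  assumes "linear P" and fixed: "\<And>j. P (kron_col j x) = kron_col j x"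
  shows "x = (\<Sum>i\<in>UNIV. kron_vec (P (axis i 1)) (kron_row i x))"
proof (subst vec_eq_iff, intro allI)
  fix p :: "'m \<times> 'n"
  obtain a j where p: "p = (a, j)"
    by (cases p)
  have "kron_col j x = P (\<Sum>i\<in>UNIV. kron_col j x $ i *\<^sub>R axis i 1)"
    using fixed[of j] basis_expansion[of "kron_col j x"] by (simp add: scalar_mult_eq_scaleR)
  also have "\<dots> = (\<Sum>i\<in>UNIV. x $ (i, j) *\<^sub>R P (axis i 1))"
    using assms(1) by (simp add: linear_sum linear_scale kron_col_def)
  finally have "kron_col j x $ a = (\<Sum>i\<in>UNIV. x $ (i, j) *\<^sub>R P (axis i 1)) $ a"
    by simp
  then show "x $ p = (\<Sum>i\<in>UNIV. kron_vec (P (axis i 1)) (kron_row i x)) $ p"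
    by (simp add: p kron_col_def kron_row_def kron_vec_def mult.commute)
qed

text \<open>
  Rows and columns of an elementary tensor are multiples of its two factors, which settles one
  direction by linearity. For the other, a linear projection onto \<open>S\<close> fixes all columns, and the
  expansion above then has its left factors in \<open>S\<close> and its right factors, the rows, in \<open>T\<close>.
\<close>

lemma mem_kron_subspace_iff:
  fixes x :: "real ^ ('m::finite \<times> 'n::finite)"
  assumes S: "subspace S" and T: "subspace T"
  shows "x \<in> kron_subspace S T \<longleftrightarrow> (\<forall>j. kron_col j x \<in> S) \<and> (\<forall>i. kron_row i x \<in> T)"
proof
  assume "x \<in> kron_subspace S T"
  moreover have "kron_subspace S T \<subseteq> kron_col j -` S" for j
    unfolding kron_subspace_def
    using linear_subspace_vimage[OF linear_kron_col S]
    by (intro span_minimal) (auto simp: kron_col_kron_vec subspace_scale[OF S])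
  moreover have "kron_subspace S T \<subseteq> kron_row i -` T" for i
    unfolding kron_subspace_def
    using linear_subspace_vimage[OF linear_kron_row T]
    by (intro span_minimal) (auto simp: kron_row_kron_vec subspace_scale[OF T])
  ultimately show "(\<forall>j. kron_col j x \<in> S) \<and> (\<forall>i. kron_row i x \<in> T)"
    by blast
next
  assume x: "(\<forall>j. kron_col j x \<in> S) \<and> (\<forall>i. kron_row i x \<in> T)"
  obtain P where P: "linear P" "\<And>v. P v \<in> S" "\<And>v. v \<in> S \<Longrightarrow> P v = v"
    using linear_projection_onto_subspace[OF S] by blast
  have "(\<Sum>i\<in>UNIV. kron_vec (P (axis i 1)) (kron_row i x)) \<in> kron_subspace S T"
    unfolding kron_subspace_def using P(2) x by (intro span_sum span_base) blast
  moreover have "x = (\<Sum>i\<in>UNIV. kron_vec (P (axis i 1)) (kron_row i x))"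
    using P x by (intro kron_expansion) auto
  ultimately show "x \<in> kron_subspace S T"
    by metis
qed

lemma kron_subspace_Int:
  fixes S S' :: "(real ^ 'm::finite) set" and T T' :: "(real ^ 'n::finite) set"
  assumes "subspace S" "subspace T" "subspace S'" "subspace T'"
  shows "kron_subspace (S \<inter> S') (T \<inter> T') = kron_subspace S T \<inter> kron_subspace S' T'"
  using assms by (auto simp: mem_kron_subspace_iff subspace_inter)

lemma kron_subspace_UNIV: "kron_subspace UNIV UNIV = (UNIV :: (real ^ ('m::finite \<times> 'n::finite)) set)"
  by (auto simp: mem_kron_subspace_iff)

lemma kron_subspace_mono:
  assumes "S \<subseteq> S'" "T \<subseteq> T'"
  shows "kron_subspace S T \<subseteq> kron_subspace S' T'"
  unfolding kron_subspace_def using assms by (intro span_mono) blast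

text \<open>
  The total dimension is a natural number, so a minimizing pair exists; intersecting it with any
  competitor cannot lower either dimension, and a subspace of full dimension is the whole space.
\<close>

lemma ex_least_subspace_pair:
  fixes Q :: "'a::euclidean_space set \<Rightarrow> 'b::euclidean_space set \<Rightarrow> bool"
  assumes UNIV: "Q UNIV UNIV"
    and Int: "\<And>S T S' T'. \<lbrakk>subspace S; subspace T; subspace S'; subspace T'; Q S T; Q S' T'\<rbrakk>
                \<Longrightarrow> Q (S \<inter> S') (T \<inter> T')"
  obtains S T where "subspace S" "subspace T" "Q S T"
    "\<And>S' T'. \<lbrakk>subspace S'; subspace T'; Q S' T'\<rbrakk> \<Longrightarrow> S \<subseteq> S' \<and> T \<subseteq> T'"
proof -
  define admissible where
    "admissible p \<longleftrightarrow> subspace (fst p) \<and> subspace (snd p) \<and> Q (fst p) (snd p)" for p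
  have "admissible (UNIV, UNIV)"
    by (simp add: admissible_def UNIV)
  then obtain p where p: "admissible p"
    and least: "\<And>q. admissible q \<Longrightarrow> dim (fst p) + dim (snd p) \<le> dim (fst q) + dim (snd q)"
    using ex_has_least_nat[of admissible _ "\<lambda>p. dim (fst p) + dim (snd p)"] by blast
  obtain S T where ST: "p = (S, T)"
    by (cases p)
  have sub: "subspace S" "subspace T" and Q: "Q S T"
    using p by (auto simp: admissible_def ST)
  show ?thesis
  proof (rule that[OF sub Q])
    fix S' T' assume sub': "subspace S'" "subspace T'" and "Q S' T'"
    then have "admissible (S \<inter> S', T \<inter> T')"
      using sub Q Int by (simp add: admissible_def subspace_inter)
    then have "dim S + dim T \<le> dim (S \<inter> S') + dim (T \<inter> T')"
      using least by (force simp: ST)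
    moreover have "dim (S \<inter> S') \<le> dim S" "dim (T \<inter> T') \<le> dim T"
      by (auto intro: dim_subset)
    ultimately have "dim S \<le> dim (S \<inter> S')" "dim T \<le> dim (T \<inter> T')"
      by linarith+
    then have "S \<inter> S' = S" "T \<inter> T' = T"
      using subspace_dim_equal[OF subspace_inter[OF sub(1) sub'(1)] sub(1)]
        subspace_dim_equal[OF subspace_inter[OF sub(2) sub'(2)] sub(2)]
      by simp_all
    then show "S \<subseteq> S' \<and> T \<subseteq> T'"
      by blast
  qed
qed

theorem theorem1:
  fixes M :: "'w measure"
    and U :: "'w \<Rightarrow> real ^ 'k ^ ('r::finite \<times> 'l::finite)"
  assumes "prob_space M"
    and "U \<in> borel_measurable M"
  shows "\<exists>(SR0 :: (real ^ 'r) set) (SL0 :: (real ^ 'l) set).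
           subspace SR0 \<and> subspace SL0 \<and>
           (AE \<omega> in M. column_span (U \<omega>) \<subseteq> kron_subspace SR0 SL0) \<and>
           (\<forall>(SR :: (real ^ 'r) set) (SL :: (real ^ 'l) set).
              subspace SR \<longrightarrow> subspace SL \<longrightarrow>
              (AE \<omega> in M. column_span (U \<omega>) \<subseteq> kron_subspace SR SL) \<longrightarrow>
              kron_subspace SR0 SL0 \<subseteq> kron_subspace SR SL)"
proof -
  let ?Q = "\<lambda>SR SL. AE \<omega> in M. column_span (U \<omega>) \<subseteq> kron_subspace SR SL"
  show ?thesis
  proof (rule ex_least_subspace_pair[of ?Q])
    show "?Q UNIV UNIV"
      by (simp add: kron_subspace_UNIV)
  next
    fix S S' :: "(real ^ 'r) set" and T T' :: "(real ^ 'l) set"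
    assume sub: "subspace S" "subspace T" "subspace S'" "subspace T'"
    assume "?Q S T" "?Q S' T'"
    then show "?Q (S \<inter> S') (T \<inter> T')"
      by eventually_elim (simp add: kron_subspace_Int sub)
  next
    fix SR0 :: "(real ^ 'r) set" and SL0 :: "(real ^ 'l) set"
    assume "subspace SR0" "subspace SL0" "?Q SR0 SL0"
      and least: "\<And>SR SL. \<lbrakk>subspace SR; subspace SL; ?Q SR SL\<rbrakk> \<Longrightarrow> SR0 \<subseteq> SR \<and> SL0 \<subseteq> SL"
    moreover have "kron_subspace SR0 SL0 \<subseteq> kron_subspace SR SL"
      if "subspace SR" "subspace SL" "?Q SR SL" for SR SL
      using least[OF that] by (simp add: kron_subspace_mono)
    ultimately show ?thesis
      by (intro exI[of _ SR0] exI[of _ SL0]) simp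
  qed
qed

end
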